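(* Let $\{P_{u,b}\}_{u\in\mathcal U,\,b\in B_u}$ be a measurement setting family on $\mathcal H=(\mathbb C^2)^{\otimes n}$ and let $O=|\psi\rangle\langle\psi|$ with $|\psi\rangle\in\mathcal H$ a unit vector. Fix real coefficients $\alpha_{u,b}$ satisfying $\sum_{u\in\mathcal U}\sum_{b\in B_u}\alpha_{u,b}P_{u,b}=O$ and fix a density operator $\rho$ on $\mathcal H$. Define $$\mu_u(\rho)=\sum_{b\in B_u}\alpha_{u,b}^2\operatorname{tr}(\rho P_{u,b})\ge 0 .$$ Then $$\inf_{q}\sum_{u\in\mathcal U}\frac{\mu_u(\rho)}{q(u)}=\left(\sum_{u\in\mathcal U}\sqrt{\mu_u(\rho)}\right)^2,$$ where the infimum is over all probability distributions $q$ on $\mathcal U$. If not all $\mu_u(\rho)$ vanish, the infimum is attained exactly by the distribution $q^\star_\rho$ with $$q_\rho^{\star}(u)=\frac{\sqrt{\mu_u(\rho)}}{\sum_{v\in\mathcal U}\sqrt{\mu_v(\rho)}}\qquad\text{whenever }\mu_u(\rho)>0 .$$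
   Context: $\mathcal H=(\mathbb C^2)^{\otimes n}$ is the $n$-qubit Hilbert space. A density operator (state) is an operator $\rho\succeq0$ on $\mathcal H$ with $\operatorname{tr}(\rho)=1$. A measurement setting family is a finite collection of operators $P_{u,b}\succeq 0$ on $\mathcal H$, indexed by settings $u\in\mathcal U$ and outcomes $b\in B_u$ (finite sets), such that $\sum_{b\in B_u}P_{u,b}=I$ for each $u\in\mathcal U$. Convention for the objective $\sum_u \mu_u(\rho)/q(u)$: a term with $q(u)=0$ and $\mu_u(\rho)>0$ equals $+\infty$, and a term with $q(u)=0$ and $\mu_u(\rho)=0$ equals $0$. *)

theory Defs
  imports "HOL-Analysis.Analysis" "HOL-Probability.Probability_Mass_Function"
begin

text \<open>The finite type \<open>'n\<close> indexes the qubits, so \<open>n = CARD('n)\<close>. The computational basis of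
  the \<open>n\<close>-fold tensor power of \<open>\<complex>\<^sup>2\<close> is indexed by bit strings \<open>'n \<Rightarrow> bool\<close>, and vectors
  and operators are given by their coordinates in this orthonormal basis, so the library's
  \<^const>\<open>norm\<close> on vectors is the Hilbert space norm.\<close>

type_synonym 'n qvec = "complex ^ ('n \<Rightarrow> bool)"
type_synonym 'n qop = "complex ^ ('n \<Rightarrow> bool) ^ ('n \<Rightarrow> bool)"

definition cinner_vec :: "complex ^ 'd \<Rightarrow> complex ^ 'd \<Rightarrow> complex" where
  "cinner_vec v w = (\<Sum>i\<in>UNIV. cnj (v $ i) * w $ i)"

definition conj_transpose :: "complex ^ 'd ^ 'd \<Rightarrow> complex ^ 'd ^ 'd" where
  "conj_transpose A = (\<chi> i j. cnj (A $ j $ i))"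

text \<open>For a Hermitian matrix the quadratic form is real-valued, so taking \<^const>\<open>Re\<close> loses
  nothing.\<close>

definition pos_semidef :: "complex ^ 'd ^ 'd \<Rightarrow> bool" where
  "pos_semidef A \<longleftrightarrow> conj_transpose A = A \<and> (\<forall>v. 0 \<le> Re (cinner_vec v (A *v v)))"

definition ketbra :: "complex ^ 'd \<Rightarrow> complex ^ 'd \<Rightarrow> complex ^ 'd ^ 'd" where
  "ketbra \<psi> \<phi> = (\<chi> i j. \<psi> $ i * cnj (\<phi> $ j))"

definition density_operator :: "complex ^ 'd ^ 'd \<Rightarrow> bool" where
  "density_operator \<rho> \<longleftrightarrow> pos_semidef \<rho> \<and> trace \<rho> = 1"

definition measurement_setting_family ::
    "'u set \<Rightarrow> ('u \<Rightarrow> 'b set) \<Rightarrow> ('u \<Rightarrow> 'b \<Rightarrow> complex ^ 'd ^ 'd) \<Rightarrow> bool" where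
  "measurement_setting_family U B P \<longleftrightarrow>
     finite U \<and>
     (\<forall>u\<in>U. finite (B u) \<and> (\<forall>b\<in>B u. pos_semidef (P u b)) \<and> (\<Sum>b\<in>B u. P u b) = mat 1)"

text \<open>The trace of a product of two Hermitian matrices is real, so \<^const>\<open>Re\<close> loses nothing when
  \<open>\<rho>\<close> and the \<open>P u b\<close> are positive semidefinite.\<close>

definition setting_moment ::
    "('u \<Rightarrow> 'b set) \<Rightarrow> ('u \<Rightarrow> 'b \<Rightarrow> complex ^ 'd ^ 'd) \<Rightarrow> ('u \<Rightarrow> 'b \<Rightarrow> real) \<Rightarrow>
     complex ^ 'd ^ 'd \<Rightarrow> 'u \<Rightarrow> real" where
  "setting_moment B P \<alpha> \<rho> u = (\<Sum>b\<in>B u. (\<alpha> u b)\<^sup>2 * Re (trace (\<rho> ** P u b)))"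

definition prob_dists_on :: "'u set \<Rightarrow> 'u pmf set" where
  "prob_dists_on U = {q. set_pmf q \<subseteq> U}"

text \<open>A term with \<open>q(u) = 0\<close> counts as \<open>0\<close> if its numerator vanishes and as \<open>\<infinity>\<close> otherwise.\<close>

definition sampling_objective :: "'u set \<Rightarrow> ('u \<Rightarrow> real) \<Rightarrow> 'u pmf \<Rightarrow> ereal" where
  "sampling_objective U m q =
     (\<Sum>u\<in>U. if pmf q u = 0 then (if m u = 0 then 0 else \<infinity>) else ereal (m u / pmf q u))"

end

theory Submission
  imports Defs
begin

text \<open>The moments are nonnegative because the trace of a product of two positive semidefinite
  matrices is nonnegative, which follows by splitting off rank-one terms from one factor as in
  the Cholesky decomposition. For the optimisation put \<open>S = (\<Sum>u\<in>U. sqrt (m u))\<close>. If \<open>m\<close> vanishes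
  wherever \<open>q\<close> does, completing the square gives
  \<open>(\<Sum>u\<in>U. m u / q u) - S\<^sup>2 = (\<Sum>u\<in>U. q u * (sqrt (m u) / q u - S)\<^sup>2)\<close>, so \<open>S\<^sup>2\<close> is a lower bound, with
  equality exactly when \<open>sqrt (m u) = S * q u\<close> for all \<open>u\<close>.\<close>

section \<open>Traces of products of positive semidefinite matrices\<close>

lemma pos_semidef_cnj:
  assumes "pos_semidef A"
  shows "cnj (A $ i $ j) = A $ j $ i"
proof -
  have "conj_transpose A $ j $ i = A $ j $ i"
    using assms by (simp add: pos_semidef_def)
  then show ?thesis by (simp add: conj_transpose_def)
qed

lemma pos_semidef_form_nonneg: "pos_semidef A \<Longrightarrow> 0 \<le> Re (cinner_vec v (A *v v))"
  by (simp add: pos_semidef_def)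

lemma matrix_vector_mult_axis: "(A *v axis i c) $ k = A $ k $ i * (c :: complex)"
  by (simp add: matrix_vector_mult_def axis_def if_distrib[of "\<lambda>x. _ * x"] cong: if_cong)

lemma cinner_vec_add_left: "cinner_vec (v + w) x = cinner_vec v x + cinner_vec w x"
  by (simp add: cinner_vec_def sum.distrib algebra_simps)

lemma cinner_vec_add_right: "cinner_vec x (v + w) = cinner_vec x v + cinner_vec x w"
  by (simp add: cinner_vec_def sum.distrib algebra_simps)

lemma cinner_vec_axis_left: "cinner_vec (axis i c) x = cnj c * x $ i"
  by (simp add: cinner_vec_def axis_def if_distrib[of cnj] if_distrib[of "\<lambda>x. x * _"] cong: if_cong)

lemma cinner_vec_matrix_axis:
  assumes "pos_semidef A"
  shows "cinner_vec v (A *v axis i c) = cnj ((A *v v) $ i) * c"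
proof -
  have "cnj ((A *v v) $ i) * c = (\<Sum>j\<in>UNIV. cnj (v $ j) * A $ j $ i) * c"
    by (simp add: matrix_vector_mult_def pos_semidef_cnj[OF assms] mult.commute)
  then show ?thesis
    by (simp add: cinner_vec_def matrix_vector_mult_axis sum_distrib_right mult.assoc)
qed

text \<open>Hermitian symmetry makes the two cross terms complex conjugates, hence twice a real
  part. Choosing \<open>c\<close> well in this quadratic polynomial yields both the vanishing of
  rows and the rank-one step below.\<close>

lemma form_add_axis:
  assumes "pos_semidef A"
  shows "Re (cinner_vec (v + axis i c) (A *v (v + axis i c))) =
    Re (cinner_vec v (A *v v)) + 2 * Re (cnj c * (A *v v) $ i) + (cmod c)\<^sup>2 * Re (A $ i $ i)"
proof -
  have "cnj c * (A $ i $ i * c) = complex_of_real ((cmod c)\<^sup>2) * A $ i $ i"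
    unfolding complex_norm_square by (simp only: ac_simps)
  then have "Re (cnj c * (A $ i $ i * c)) = (cmod c)\<^sup>2 * Re (A $ i $ i)"
    by (simp only: Re_complex_of_real times_complex.sel Im_complex_of_real)
  then show ?thesis
    by (simp add: matrix_vector_right_distrib cinner_vec_add_left cinner_vec_add_right
        cinner_vec_axis_left cinner_vec_matrix_axis[OF assms] matrix_vector_mult_axis algebra_simps)
qed

lemma pos_semidef_diag:
  assumes "pos_semidef A"
  shows "A $ i $ i = complex_of_real (Re (A $ i $ i))" and "0 \<le> Re (A $ i $ i)"
proof -
  show "A $ i $ i = complex_of_real (Re (A $ i $ i))"
    using arg_cong[OF pos_semidef_cnj[OF assms, of i i], of Im] by (simp add: complex_eq_iff)
  show "0 \<le> Re (A $ i $ i)"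
    using pos_semidef_form_nonneg[OF assms, of "axis i 1"]
    by (simp add: cinner_vec_axis_left matrix_vector_mult_axis)
qed

text \<open>With \<open>A $ i $ i = 0\<close> the form at \<open>axis j 1 + axis i c\<close> has no
  quadratic term in \<open>c\<close>, so a nonzero \<open>A $ i $ j\<close> could drive it below
  zero.\<close>

lemma pos_semidef_diag_zero:
  assumes "pos_semidef A" and "A $ i $ i = 0"
  shows "A $ i $ j = 0"
proof (rule ccontr)
  assume nz: "A $ i $ j \<noteq> 0"
  define N where "N = (cmod (A $ i $ j))\<^sup>2"
  \<comment> \<open>This \<open>s\<close> is chosen so that the cross term equals
    \<open>- (Re (A $ j $ j) + 1)\<close>, which brings the form down to -1.\<close>
  define s where "s = (Re (A $ j $ j) + 1) / (2 * N)"
  define c where "c = - complex_of_real s * A $ i $ j"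
  have "N > 0" using nz by (simp add: N_def)
  have "cnj c * A $ i $ j = - complex_of_real (s * N)"
    by (simp add: c_def N_def complex_norm_square del: of_real_power)
  then have "Re (cnj c * A $ i $ j) = - (s * N)" by simp
  then have "0 \<le> Re (A $ j $ j) - 2 * (s * N)"
    using pos_semidef_form_nonneg[OF assms(1), of "axis j 1 + axis i c"] assms(2)
    unfolding form_add_axis[OF assms(1)]
    by (simp add: cinner_vec_axis_left matrix_vector_mult_axis)
  moreover have "2 * (s * N) = Re (A $ j $ j) + 1" using \<open>N > 0\<close> by (simp add: s_def)
  ultimately show False by simp
qed

section \<open>Rank-one reduction and nonnegativity of the trace\<close>

lemma ketbra_mult_vec: "ketbra x y *v v = cinner_vec y v *s x"
  by (simp add: vec_eq_iff ketbra_def matrix_vector_mult_def cinner_vec_def sum_distrib_left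
      ac_simps)

lemma trace_ketbra_mult: "trace (ketbra x y ** B) = cinner_vec y (B *v x)"
proof -
  have "trace (ketbra x y ** B) = (\<Sum>i\<in>UNIV. \<Sum>k\<in>UNIV. x $ i * cnj (y $ k) * B $ k $ i)"
    by (simp add: trace_def matrix_matrix_mult_def ketbra_def)
  also have "\<dots> = (\<Sum>k\<in>UNIV. \<Sum>i\<in>UNIV. x $ i * cnj (y $ k) * B $ k $ i)"
    by (rule sum.swap)
  also have "\<dots> = cinner_vec y (B *v x)"
    by (simp add: cinner_vec_def matrix_vector_mult_def sum_distrib_left ac_simps)
  finally show ?thesis .
qed

lemma trace_scaleR: "trace (r *\<^sub>R A) = r *\<^sub>R trace (A :: complex ^ 'd ^ 'd)"
  by (simp add: trace_def scaleR_sum_right)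

text \<open>This is a Schur complement: the form of the reduced matrix at \<open>v\<close> is the
  minimum over \<open>c\<close> of the form of \<open>A\<close> at \<open>v + axis i c\<close>,
  hence nonnegative.\<close>

lemma pos_semidef_rank_one_step:
  assumes A: "pos_semidef A" and nz: "A $ i $ i \<noteq> 0"
  shows "pos_semidef (A - (1 / Re (A $ i $ i)) *\<^sub>R ketbra (column i A) (column i A))"
    (is "pos_semidef (A - (1 / ?a) *\<^sub>R ?K)")
proof -
  have a: "?a > 0"
    using pos_semidef_diag[OF A, of i] nz by (metis less_eq_real_def of_real_0)
  have "0 \<le> Re (cinner_vec v ((A - (1 / ?a) *\<^sub>R ?K) *v v))" for v
  proof -
    define w where "w = (A *v v) $ i"
    \<comment> \<open>The minimiser of \<open>2 * Re (cnj c * w) + (cmod c)\<^sup>2 * ?a\<close>,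
      whose minimum is \<open>- (cmod w)\<^sup>2 / ?a\<close>.\<close>
    define c where "c = - complex_of_real (1 / ?a) * w"
    have col: "cinner_vec (column i A) v = w"
      by (simp add: cinner_vec_def column_def w_def matrix_vector_mult_def pos_semidef_cnj[OF A])
    have row: "cinner_vec v (column i A) = cnj w"
      by (simp add: col[symmetric] cinner_vec_def mult.commute)
    have K: "cinner_vec v (?K *v v) = complex_of_real ((cmod w)\<^sup>2)"
    proof -
      have "cinner_vec v (w *s x) = w * cinner_vec v x" for x
        by (simp add: cinner_vec_def sum_distrib_left ac_simps)
      then show ?thesis
        by (simp add: ketbra_mult_vec col row complex_norm_square del: of_real_power)
    qed
    have "cnj c * w = - (w * cnj w / complex_of_real ?a)" by (simp add: c_def)
    then have "cnj c * w = - complex_of_real ((cmod w)\<^sup>2 / ?a)"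
      by (simp only: complex_norm_square of_real_divide)
    then have "Re (cnj c * w) = - ((cmod w)\<^sup>2 / ?a)" by simp
    moreover have "(cmod c)\<^sup>2 * ?a = (cmod w)\<^sup>2 / ?a"
      using a by (simp add: c_def norm_mult norm_divide power_mult_distrib power_divide
          power2_eq_square)
    ultimately have "0 \<le> Re (cinner_vec v (A *v v)) - (cmod w)\<^sup>2 / ?a"
      using pos_semidef_form_nonneg[OF A, of "v + axis i c"]
      unfolding form_add_axis[OF A] by (simp add: w_def)
    also have "\<dots> = Re (cinner_vec v ((A - (1 / ?a) *\<^sub>R ?K) *v v))"
    proof -
      have "cinner_vec v ((A - r *\<^sub>R L) *v v) =
          cinner_vec v (A *v v) - r *\<^sub>R cinner_vec v (L *v v)" for r L
        by (simp add: cinner_vec_def matrix_vector_mult_def sum_subtractf left_diff_distrib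
            right_diff_distrib flip: scaleR_sum_right)
      then show ?thesis by (simp add: K del: of_real_power)
    qed
    finally show ?thesis .
  qed
  moreover have "conj_transpose (A - (1 / ?a) *\<^sub>R ?K) = A - (1 / ?a) *\<^sub>R ?K"
    by (simp add: vec_eq_iff conj_transpose_def ketbra_def pos_semidef_cnj[OF A] mult.commute)
  ultimately show ?thesis by (simp add: pos_semidef_def)
qed

text \<open>Induction on the number of nonzero diagonal entries of \<open>A\<close>. Each split-off
  rank-one term contributes a positive multiple of the form of \<open>B\<close> at a column of
  \<open>A\<close>; once the diagonal is zero, so is the matrix.\<close>

lemma trace_mult_pos_semidef_nonneg:
  assumes "pos_semidef A" and "pos_semidef B"
  shows "0 \<le> Re (trace (A ** B))"
  using assms(1)
proof (induction "card {i. A $ i $ i \<noteq> 0}" arbitrary: A rule: less_induct)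
  case less
  show ?case
  proof (cases "\<exists>i. A $ i $ i \<noteq> 0")
    case False
    then have "A = 0"
      using pos_semidef_diag_zero[OF less.prems] by (simp add: vec_eq_iff)
    then show ?thesis by (simp add: trace_def)
  next
    case True
    then obtain i where i: "A $ i $ i \<noteq> 0" by blast
    define a where "a = Re (A $ i $ i)"
    define K where "K = ketbra (column i A) (column i A)"
    define A' where "A' = A - (1 / a) *\<^sub>R K"
    have Aii: "A $ i $ i = complex_of_real a"
      using pos_semidef_diag(1)[OF less.prems] by (simp add: a_def)
    then have a: "a > 0"
      using pos_semidef_diag(2)[OF less.prems, of i] i by (auto simp: a_def less_le)
    have A': "pos_semidef A'"
      using pos_semidef_rank_one_step[OF less.prems i] by (simp add: A'_def a_def K_def)
    have "A' $ i $ i = A $ i $ i - (1 / a) *\<^sub>R (A $ i $ i * cnj (A $ i $ i))"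
      by (simp add: A'_def K_def ketbra_def column_def)
    then have "A' $ i $ i = 0"
      using a by (simp add: Aii scaleR_conv_of_real)
    \<comment> \<open>A zero diagonal entry kills row \<open>j\<close> of \<open>A\<close>, so the
      subtracted column has a zero there and no new nonzero diagonal entry appears.\<close>
    moreover have "A' $ j $ j = 0" if "A $ j $ j = 0" for j
      using pos_semidef_diag_zero[OF less.prems that] by (simp add: A'_def K_def ketbra_def column_def)
    ultimately have "{j. A' $ j $ j \<noteq> 0} \<subset> {j. A $ j $ j \<noteq> 0}"
      using i by blast
    then have "0 \<le> Re (trace (A' ** B))"
      by (intro less.hyps A' psubset_card_mono) auto
    moreover have "0 \<le> Re (trace (K ** B))"
      using pos_semidef_form_nonneg[OF assms(2)] by (simp add: K_def trace_ketbra_mult)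
    moreover have "trace (A ** B) = trace (A' ** B) + (1 / a) *\<^sub>R trace (K ** B)"
    proof -
      have "A ** B = A' ** B + (1 / a) *\<^sub>R (K ** B)"
        by (simp add: A'_def vec_eq_iff matrix_matrix_mult_def left_diff_distrib sum_subtractf
            scaleR_sum_right)
      then show ?thesis by (simp add: trace_add trace_scaleR)
    qed
    ultimately show ?thesis using a by simp
  qed
qed

text \<open>Conjugation reverses the order of two Hermitian factors, and the trace does not see that
  order.\<close>

lemma trace_mult_pos_semidef_real:
  assumes "pos_semidef A" and "pos_semidef B"
  shows "complex_of_real (Re (trace (A ** B))) = trace (A ** B)"
proof -
  have "cnj (trace (A ** B)) = trace (B ** A)"
    by (simp add: trace_def matrix_matrix_mult_def pos_semidef_cnj[OF assms(1)]
        pos_semidef_cnj[OF assms(2)] mult.commute)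
  then have "cnj (trace (A ** B)) = trace (A ** B)"
    using trace_mul_sym[of A B] by metis
  then show ?thesis by (simp add: complex_eq_iff)
qed

section \<open>Optimal sampling\<close>

lemma prob_dists_on_sum:
  assumes "finite U" and "q \<in> prob_dists_on U"
  shows "(\<Sum>u\<in>U. pmf q u) = 1"
  using assms by (simp add: prob_dists_on_def sum_pmf_eq_1)

lemma sampling_objective_finite:
  assumes "finite U" and "q \<in> prob_dists_on U" and "\<And>u. u \<in> U \<Longrightarrow> 0 \<le> m u"
    and "\<And>u. u \<in> U \<Longrightarrow> pmf q u = 0 \<Longrightarrow> m u = 0"
  defines "S \<equiv> \<Sum>u\<in>U. sqrt (m u)"
  shows "sampling_objective U m q =
    ereal (S\<^sup>2 + (\<Sum>u\<in>U. pmf q u * (sqrt (m u) / pmf q u - S)\<^sup>2))"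
proof -
  have "pmf q u * (sqrt (m u) / pmf q u - S)\<^sup>2
      = m u / pmf q u - 2 * S * sqrt (m u) + S\<^sup>2 * pmf q u" if "u \<in> U" for u
  proof (cases "pmf q u = 0")
    \<comment> \<open>Here \<open>m u = 0\<close>, and division by zero gives 0, so both sides
      vanish.\<close>
    case True
    then show ?thesis using assms(4)[OF that] by simp
  next
    case False
    have "m u = (sqrt (m u))\<^sup>2" using assms(3)[OF that] by simp
    then show ?thesis using False by (simp add: power2_eq_square field_simps)
  qed
  then have "(\<Sum>u\<in>U. pmf q u * (sqrt (m u) / pmf q u - S)\<^sup>2)
      = (\<Sum>u\<in>U. m u / pmf q u - 2 * S * sqrt (m u) + S\<^sup>2 * pmf q u)"
    by simp
  \<comment> \<open>Since \<open>q\<close> sums to 1, the last two sums combine to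
    \<open>- S\<^sup>2\<close>.\<close>
  also have "\<dots> = (\<Sum>u\<in>U. m u / pmf q u) - 2 * S * S + S\<^sup>2 * 1"
    unfolding prob_dists_on_sum[OF assms(1,2), symmetric]
    by (simp add: sum.distrib sum_subtractf sum_distrib_left S_def)
  finally have *: "S\<^sup>2 + (\<Sum>u\<in>U. pmf q u * (sqrt (m u) / pmf q u - S)\<^sup>2) = (\<Sum>u\<in>U. m u / pmf q u)"
    by (simp add: power2_eq_square)
  have "sampling_objective U m q = (\<Sum>u\<in>U. ereal (m u / pmf q u))"
    unfolding sampling_objective_def
    by (rule sum.cong) (use assms(4) in \<open>auto simp: zero_ereal_def\<close>)
  then show ?thesis by (simp add: *)
qed

lemma sampling_objective_infinite:
  assumes "finite U" and "u \<in> U" and "pmf q u = 0" and "m u \<noteq> 0"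
  shows "sampling_objective U m q = \<infinity>"
  unfolding sampling_objective_def using assms by (auto simp: sum_Pinfty)

text \<open>The equality condition is written without division, so that it stays meaningful when
  \<open>S = 0\<close> or \<open>pmf q u = 0\<close>.\<close>

lemma sampling_objective_bound:
  assumes "finite U" and "q \<in> prob_dists_on U" and "\<And>u. u \<in> U \<Longrightarrow> 0 \<le> m u"
  shows "ereal ((\<Sum>u\<in>U. sqrt (m u))\<^sup>2) \<le> sampling_objective U m q"
    and "sampling_objective U m q = ereal ((\<Sum>u\<in>U. sqrt (m u))\<^sup>2) \<longleftrightarrow>
      (\<forall>u\<in>U. sqrt (m u) = (\<Sum>v\<in>U. sqrt (m v)) * pmf q u)" (is "_ \<longleftrightarrow> ?opt")
proof -
  define S where "S = (\<Sum>u\<in>U. sqrt (m u))"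
  have "ereal (S\<^sup>2) \<le> sampling_objective U m q \<and>
    (sampling_objective U m q = ereal (S\<^sup>2) \<longleftrightarrow> (\<forall>u\<in>U. sqrt (m u) = S * pmf q u))"
  proof (cases "\<forall>u\<in>U. pmf q u = 0 \<longrightarrow> m u = 0")
    case False
    then obtain u where u: "u \<in> U" "pmf q u = 0" "m u \<noteq> 0" by blast
    then have "sampling_objective U m q = \<infinity>"
      using assms(1) by (rule sampling_objective_infinite[rotated])
    \<comment> \<open>The objective is infinite here, and the equality condition fails as well,
      because its right side is 0 at \<open>u\<close>.\<close>
    moreover have "sqrt (m u) \<noteq> S * pmf q u" using u by simp
    ultimately show ?thesis using u(1) by auto
  next
    case True
    define D where "D u = pmf q u * (sqrt (m u) / pmf q u - S)\<^sup>2" for u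
    have obj: "sampling_objective U m q = ereal (S\<^sup>2 + sum D U)"
      unfolding S_def D_def
      by (rule sampling_objective_finite) (use assms True in auto)
    have D0: "D u \<ge> 0" for u by (simp add: D_def)
    \<comment> \<open>If \<open>pmf q u = 0\<close>, then \<open>m u = 0\<close> by the case
      assumption and both sides of the equivalence hold.\<close>
    have "D u = 0 \<longleftrightarrow> sqrt (m u) = S * pmf q u" if "u \<in> U" for u
      using True that by (auto simp: D_def field_simps)
    then have "sum D U = 0 \<longleftrightarrow> (\<forall>u\<in>U. sqrt (m u) = S * pmf q u)"
      using sum_nonneg_eq_0_iff[OF assms(1), of D] D0 by auto
    moreover have "0 \<le> sum D U" by (simp add: D0 sum_nonneg)
    ultimately show ?thesis by (simp add: obj)
  qed
  then show "ereal ((\<Sum>u\<in>U. sqrt (m u))\<^sup>2) \<le> sampling_objective U m q"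
    and "sampling_objective U m q = ereal ((\<Sum>u\<in>U. sqrt (m u))\<^sup>2) \<longleftrightarrow> ?opt"
    by (simp_all add: S_def)
qed

lemma optimal_dist_exists:
  assumes "finite U" and "U \<noteq> {}" and "\<And>u. u \<in> U \<Longrightarrow> 0 \<le> m u"
  shows "\<exists>q\<in>prob_dists_on U. \<forall>u\<in>U. sqrt (m u) = (\<Sum>v\<in>U. sqrt (m v)) * pmf q u"
proof -
  define S where "S = (\<Sum>u\<in>U. sqrt (m u))"
  show ?thesis
  proof (cases "S = 0")
    case True
    then have "\<forall>u\<in>U. sqrt (m u) = 0"
      using sum_nonneg_eq_0_iff[OF assms(1), of "\<lambda>u. sqrt (m u)"] assms(3) by (simp add: S_def)
    moreover obtain u where "u \<in> U" using assms(2) by blast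
    ultimately show ?thesis
      \<comment> \<open>All moments vanish, so every distribution satisfies the equations; a point
        mass in \<open>U\<close> serves.\<close>
      using True by (intro bexI[of _ "return_pmf u"]) (auto simp: prob_dists_on_def S_def)
  next
    case False
    then have S: "S > 0"
      using sum_nonneg[of U "\<lambda>u. sqrt (m u)"] assms(3) by (simp add: S_def less_le)
    define f where "f u = (if u \<in> U then sqrt (m u) / S else 0)" for u
    have f0: "f u \<ge> 0" for u using S assms(3) by (simp add: f_def)
    have "(\<integral>\<^sup>+ u. ennreal (f u) \<partial>count_space UNIV) = (\<Sum>u\<in>U. ennreal (f u))"
      by (rule nn_integral_count_space'[OF assms(1)]) (auto simp: f_def)
    also have "\<dots> = ennreal (\<Sum>u\<in>U. f u)" by (simp add: f0 sum_ennreal)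
    also have "(\<Sum>u\<in>U. f u) = 1"
      using S by (simp add: f_def sum_divide_distrib[symmetric] S_def[symmetric])
    finally have pmf: "pmf (embed_pmf f) u = f u" for u
      by (intro pmf_embed_pmf f0) simp
    have "embed_pmf f \<in> prob_dists_on U"
      by (auto simp: prob_dists_on_def set_pmf_eq pmf f_def split: if_splits)
    moreover have "\<forall>u\<in>U. sqrt (m u) = S * pmf (embed_pmf f) u"
      using S by (simp add: pmf f_def)
    ultimately show ?thesis by (auto simp: S_def)
  qed
qed

text \<open>The normalisation of \<open>q\<close> forces \<open>q u = 0\<close> where \<open>m u = 0\<close>, so prescribing \<open>q\<close> where
  \<open>m\<close> is positive determines it.\<close>

lemma optimal_dist_iff:
  assumes "finite U" and "q \<in> prob_dists_on U" and "\<And>u. u \<in> U \<Longrightarrow> 0 \<le> m u"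
    and "(\<Sum>v\<in>U. sqrt (m v)) > 0" (is "?S > 0")
  shows "(\<forall>u\<in>U. m u > 0 \<longrightarrow> pmf q u = sqrt (m u) / ?S) \<longleftrightarrow>
    (\<forall>u\<in>U. sqrt (m u) = ?S * pmf q u)"
proof
  assume *: "\<forall>u\<in>U. m u > 0 \<longrightarrow> pmf q u = sqrt (m u) / ?S"
  have "sqrt (m u) / ?S = pmf q u" if "u \<in> U" for u
  \<comment> \<open>Both families sum to 1 and one dominates the other pointwise: they agree where
    \<open>m\<close> is positive, and elsewhere the left side is 0. Hence they are equal.\<close>
  proof (rule sum_mono_inv[OF _ _ that assms(1)])
    show "(\<Sum>u\<in>U. sqrt (m u) / ?S) = (\<Sum>u\<in>U. pmf q u)"
      using assms(4) by (simp add: prob_dists_on_sum[OF assms(1,2)] sum_divide_distrib[symmetric])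
    show "sqrt (m v) / ?S \<le> pmf q v" if "v \<in> U" for v
      using * assms(3)[OF that] that by (cases "m v = 0") auto
  qed
  then show "\<forall>u\<in>U. sqrt (m u) = ?S * pmf q u" using assms(4) by (auto simp: field_simps)
qed (use assms(4) in \<open>auto simp: field_simps\<close>)

theorem theorem1:
  fixes U :: "'u set"
    and B :: "'u \<Rightarrow> 'b set"
    and P :: "'u \<Rightarrow> 'b \<Rightarrow> ('n::finite) qop"
    and \<alpha> :: "'u \<Rightarrow> 'b \<Rightarrow> real"
    and \<psi> :: "'n qvec"
    and \<rho> :: "'n qop"
    and \<mu> :: "'u \<Rightarrow> real"
  assumes "measurement_setting_family U B P"
    and "norm \<psi> = 1"
    and "(\<Sum>u\<in>U. \<Sum>b\<in>B u. \<alpha> u b *\<^sub>R P u b) = ketbra \<psi> \<psi>"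
    and "density_operator \<rho>"
    and "\<mu> = setting_moment B P \<alpha> \<rho>"
  shows "(\<forall>u\<in>U. complex_of_real (\<mu> u) =
                   (\<Sum>b\<in>B u. complex_of_real ((\<alpha> u b)\<^sup>2) * trace (\<rho> ** P u b)) \<and>
                 0 \<le> \<mu> u) \<and>
         (INF q\<in>prob_dists_on U. sampling_objective U \<mu> q) =
           ereal ((\<Sum>u\<in>U. sqrt (\<mu> u))\<^sup>2) \<and>
         ((\<exists>u\<in>U. \<mu> u \<noteq> 0) \<longrightarrow>
           (\<exists>qs. {q \<in> prob_dists_on U.
                    \<forall>u\<in>U. \<mu> u > 0 \<longrightarrow> pmf q u = sqrt (\<mu> u) / (\<Sum>v\<in>U. sqrt (\<mu> v))} = {qs} \<and>
                 {q \<in> prob_dists_on U. sampling_objective U \<mu> q =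
                    (INF q'\<in>prob_dists_on U. sampling_objective U \<mu> q')} = {qs}))"
proof -
  have fin: "finite U" using assms(1) by (simp add: measurement_setting_family_def)
  have moment: "complex_of_real (\<mu> u) =
      (\<Sum>b\<in>B u. complex_of_real ((\<alpha> u b)\<^sup>2) * trace (\<rho> ** P u b)) \<and> 0 \<le> \<mu> u" if "u \<in> U" for u
  proof -
    have psd: "pos_semidef \<rho>" "\<And>b. b \<in> B u \<Longrightarrow> pos_semidef (P u b)"
      using assms(1,4) that by (auto simp: measurement_setting_family_def density_operator_def)
    have "complex_of_real (\<mu> u) =
        (\<Sum>b\<in>B u. complex_of_real ((\<alpha> u b)\<^sup>2) * complex_of_real (Re (trace (\<rho> ** P u b))))"
      by (simp add: assms(5) setting_moment_def)
    also have "\<dots> = (\<Sum>b\<in>B u. complex_of_real ((\<alpha> u b)\<^sup>2) * trace (\<rho> ** P u b))"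
      by (intro sum.cong refl) (simp add: trace_mult_pos_semidef_real psd)
    finally show ?thesis
      by (simp add: assms(5) setting_moment_def sum_nonneg trace_mult_pos_semidef_nonneg psd)
  qed
  then have nonneg: "\<And>u. u \<in> U \<Longrightarrow> 0 \<le> \<mu> u" by blast
  \<comment> \<open>An empty sum would force the rank-one projector to be 0, contradicting the unit
    norm of \<psi>. Thus probability distributions on \<open>U\<close> exist.\<close>
  have "U \<noteq> {}"
  proof
    assume "U = {}"
    then have "ketbra \<psi> \<psi> = 0" using assms(3) by simp
    then have "\<psi> = 0" by (simp add: vec_eq_iff ketbra_def)
    then show False using assms(2) by simp
  qed
  define S where "S = (\<Sum>u\<in>U. sqrt (\<mu> u))"
  obtain qs where qs: "qs \<in> prob_dists_on U" "\<forall>u\<in>U. sqrt (\<mu> u) = S * pmf qs u"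
    using optimal_dist_exists[where m = \<mu>, OF fin \<open>U \<noteq> {}\<close> nonneg] unfolding S_def by blast
  note bound = sampling_objective_bound[where m = \<mu>, OF fin _ nonneg, folded S_def]
  have inf: "(INF q\<in>prob_dists_on U. sampling_objective U \<mu> q) = ereal (S\<^sup>2)"
  proof (rule antisym)
    show "(INF q\<in>prob_dists_on U. sampling_objective U \<mu> q) \<le> ereal (S\<^sup>2)"
      using qs bound(2)[OF qs(1)] by (intro INF_lower2[of qs]) auto
  qed (auto intro: INF_greatest bound(1))
  have "{q \<in> prob_dists_on U. \<forall>u\<in>U. \<mu> u > 0 \<longrightarrow> pmf q u = sqrt (\<mu> u) / S} = {qs} \<and>
      {q \<in> prob_dists_on U. sampling_objective U \<mu> q = ereal (S\<^sup>2)} = {qs}"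
    if nz: "\<exists>u\<in>U. \<mu> u \<noteq> 0"
  proof -
    obtain u where u: "u \<in> U" "\<mu> u \<noteq> 0" using nz by blast
    have S: "S > 0"
      unfolding S_def
      by (rule sum_pos2[OF fin u(1)]) (use nonneg u in \<open>auto simp: less_le\<close>)
    \<comment> \<open>As \<open>S > 0\<close>, the equations fix \<open>q\<close> on
      \<open>U\<close>; outside \<open>U\<close> the support condition makes it 0.\<close>
    have "q = qs" if q: "q \<in> prob_dists_on U" and opt: "\<forall>u\<in>U. sqrt (\<mu> u) = S * pmf q u" for q
    proof (rule pmf_eqI)
      fix v
      show "pmf q v = pmf qs v"
      proof (cases "v \<in> U")
        case True
        then have "S * pmf q v = S * pmf qs v" using True opt qs(2) by metis
        then show ?thesis using S by simp
      next
        case False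
        then have "v \<notin> set_pmf q" "v \<notin> set_pmf qs"
          using q qs(1) by (auto simp: prob_dists_on_def)
        then show ?thesis by (simp add: set_pmf_iff)
      qed
    qed
    then have "{q \<in> prob_dists_on U. \<forall>u\<in>U. sqrt (\<mu> u) = S * pmf q u} = {qs}"
      using qs by blast
    \<comment> \<open>The prescribed distributions and the minimisers are both identified with the
      solutions of the same multiplicative equations.\<close>
    moreover have "{q \<in> prob_dists_on U. \<forall>u\<in>U. \<mu> u > 0 \<longrightarrow> pmf q u = sqrt (\<mu> u) / S} =
        {q \<in> prob_dists_on U. \<forall>u\<in>U. sqrt (\<mu> u) = S * pmf q u}"
      by (intro Collect_cong conj_cong refl
          optimal_dist_iff[where m = \<mu>, OF fin _ nonneg, folded S_def] S)
    moreover have "{q \<in> prob_dists_on U. sampling_objective U \<mu> q = ereal (S\<^sup>2)} =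
        {q \<in> prob_dists_on U. \<forall>u\<in>U. sqrt (\<mu> u) = S * pmf q u}"
      by (intro Collect_cong conj_cong refl bound(2))
    ultimately show ?thesis by simp
  qed
  then show ?thesis
    unfolding S_def[symmetric] inf using moment by blast
qed

end
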